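(* Let $\mathcal{P}$ be a set of participants, $G$ a bounded global type, $N$ a network and $M$ a queue. If $\vdash_{\mathcal{P}} G : N \parallel M$ is derivable (with empty history), then the session $N\parallel M$ is $\mathcal{P}$-lock-free.
   Context: Labels are ranged over by $\lambda$, participants by $p,q,r,s$. Processes are the possibly infinite but regular (finitely many distinct subterms) terms coinductively generated by $P ::= \mathbf{0} \mid q!\{\lambda_i.P_i\}_{i\in I} \mid q?\{\lambda_i.P_i\}_{i\in I}$, with $I$ finite and nonempty and the $\lambda_i$ pairwise distinct; $q!\{\lambda_i.P_i\}$ sends one of the $\lambda_i$ to $q$ and continues as $P_i$, $q?\{\lambda_i.P_i\}$ waits to receive one of the $\lambda_i$ from $q$ and continues as $P_i$. $\mathrm{plays}(P)$ is the smallest set with $\mathrm{plays}(\mathbf{0})=\emptyset$ and $\mathrm{plays}(q!\{\lambda_i.P_i\}_{i\in I})=\mathrm{plays}(q?\{\lambda_i.P_i\}_{i\in I})=\{q\}\cup\bigcup_{i\in I}\mathrm{plays}(P_i)$. A message is a triple $(p,\lambda,q)$ (sender $p$, label $\lambda$, receiver $q$). A queue $M$ is a finite sequence of messages ($\emptyset$ empty, $\cdot$ concatenation), taken modulo the equivalence that swaps two adjacent messages $(p,\lambda,q)$ and $(r,\lambda',s)$ whenever $p\neq r$ or $q\neq s$. A network is $N=p_1[P_1]\parallel\cdots\parallel p_n[P_n]$ with the $p_h$ pairwise distinct and $p_h\notin\mathrm{plays}(P_h)$, taken modulo permutation of components and adding/removing components $p[\mathbf{0}]$. We write $p[P]\in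 N$ if $P\neq\mathbf{0}$ and $N\equiv p[P]\parallel N'$ for some $N'$; $\mathrm{Plays}(N)=\{p\mid p[P]\in N\}$. A session is $N\parallel M$. Communications $\beta$ are $pq!\lambda$ ($p$ sends $\lambda$ to $q$) or $pq?\lambda$ ($p$ reads $\lambda$ sent by $q$), with $\mathrm{play}(pq!\lambda)=\mathrm{play}(pq?\lambda)=p$. The session transition relation is given by: (Send) $p[q!\{\lambda_i.P_i\}_{i\in I}]\parallel N\parallel M \xrightarrow{pq!\lambda_h} p[P_h]\parallel N\parallel M\cdot(p,\lambda_h,q)$ for $h\in I$; (Rcv) $p[q?\{\lambda_i.P_i\}_{i\in I}]\parallel N\parallel (q,\lambda_h,p)\cdot M \xrightarrow{pq?\lambda_h} p[P_h]\parallel N\parallel M$ for $h\in I$. For a finite trace $\tau=\beta_1\cdots\beta_n$, $\xrightarrow{\tau}$ is the composition of the $\xrightarrow{\beta_i}$ (identity for the empty trace), and $S\xrightarrow{\tau}$ means $S\xrightarrow{\tau}S'$ for some $S'$. A session $N\parallel M$ is $p$-lock-free if whenever $N\parallel M\xrightarrow{\tau}N'\parallel M'$ and $p[P]\in N'$, there exist $\tau'$ and $\beta$ with $\mathrm{play}(\beta)=p$ and $N'\parallel M'\xrightarrow{\tau'\cdot\beta}$. It is $\mathcal{P}$-lock-free if it is $p$-lock-free for every $p\in\mathcal{P}$. Global types are regular coinductive terms $G ::= pq!\{\lambda_i.G_i\}_{i\in I} \mid pq?\lambda.G \mid \mathsf{End}$ with $p\neq q$, $I$ nonempty, labels pairwise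 distinct; $pq!\{\lambda_i.G_i\}$ means $p$ sends some $\lambda_i$ to $q$ then $G_i$; $pq?\lambda.G$ means $p$ reads $\lambda$ sent by $q$ then $G$. $\mathrm{Plays}(G)$ is the smallest set with $\mathrm{Plays}(\mathsf{End})=\emptyset$, $\mathrm{Plays}(pq!\{\lambda_i.G_i\}_{i\in I})=\{p\}\cup\bigcup_i\mathrm{Plays}(G_i)$, $\mathrm{Plays}(pq?\lambda.G)=\{p\}\cup\mathrm{Plays}(G)$. $\mathrm{Paths}(G)$ is the greatest set of finite or infinite sequences of communications with $\mathrm{Paths}(\mathsf{End})=\{\epsilon\}$, $\mathrm{Paths}(pq!\{\lambda_i.G_i\}_{i\in I})=\bigcup_{i}\{pq!\lambda_i\cdot\xi\mid\xi\in\mathrm{Paths}(G_i)\}$, $\mathrm{Paths}(pq?\lambda.G)=\{pq?\lambda\cdot\xi\mid \xi\in\mathrm{Paths}(G)\}$; $\xi[n]$ is the $n$-th communication of $\xi$. $\mathrm{depth}(\xi,p)=\inf\{n\mid\mathrm{play}(\xi[n])=p\}$ (with $\inf\emptyset=\infty$); $\mathrm{depth}(G,p)=\sup\{\mathrm{depth}(\xi,p)\mid\xi\in\mathrm{Paths}(G)\}$ if $p\in\mathrm{Plays}(G)$, and $0$ otherwise. $G$ is bounded if $\mathrm{depth}(G',p)$ is finite for every $p\in\mathrm{Plays}(G)$ and every global type $G'$ occurring in $G$. Weight of a message: $\mathrm{wg}((p,\lambda,q),G)=0$ if $G=qp?\lambda.G'$; $=\infty$ if $G=\mathsf{End}$ or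 $G=qp?\lambda'.G'$ with $\lambda'\neq\lambda$; $=1+\max_{i\in I}\mathrm{wg}((p,\lambda,q),G_i)$ if $G=rs!\{\lambda_i.G_i\}_{i\in I}$; $=1+\mathrm{wg}((p,\lambda,q),G')$ if $G=rs?\lambda'.G'$ with $r\neq q$ or $s\neq p$. A type configuration $G\parallel M$ is $\mathcal{P}$-sound if $\mathrm{wg}((p,\lambda,q),G)$ is finite for every message $(p,\lambda,q)$ occurring in $M$ with $\{p,q\}\subseteq\mathcal{P}$. A history $H$ is a finite set of pairs $(N\parallel M, G)$; $(N\parallel -,G)\in H$ means $(N\parallel M,G)\in H$ for some $M$; $H,(S,G)$ denotes $H\cup\{(S,G)\}$. Judgements $H\vdash_{\mathcal{P}} G : N\parallel M$ (with $G$ bounded) are derived inductively (finite derivations) by: (End) $H\vdash_{\mathcal{P}}\mathsf{End}:N\parallel M$ if $\mathrm{Plays}(N)\cap\mathcal{P}=\emptyset$ and $\mathsf{End}\parallel M$ is $\mathcal{P}$-sound. (Cycle) $H\vdash_{\mathcal{P}} G:N\parallel M$ if $(N\parallel M,G)\in H$. (Out) if $G=pq!\{\lambda_i.G_i\}_{i\in I}$, $P=q!\{\lambda_i.P_i\}_{i\in I}$, $G\parallel M$ is $\mathcal{P}$-sound, $(p[P]\parallel N\parallel -,G)\notin H$, $(\mathrm{Plays}(N)\setminus\mathrm{Plays}(G))\cap\mathcal{P}=\emptyset$, and $H,(p[P]\parallel N\parallel M,G)\vdash_{\mathcal{P}} G_i : p[P_i]\parallel N\parallel M\cdot(p,\lambda_i,q)$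 for all $i\in I$, then $H\vdash_{\mathcal{P}} G:p[P]\parallel N\parallel M$. (In) if $G=pq?\lambda_h.G'$, $P=q?\{\lambda_i.P_i\}_{i\in I}$ with $h\in I$, $G'\parallel M$ is $\mathcal{P}$-sound, $(p[P]\parallel N\parallel -,G)\notin H$, $(\mathrm{Plays}(N)\setminus\mathrm{Plays}(G))\cap\mathcal{P}=\emptyset$, and $H,(p[P]\parallel N\parallel M,G)\vdash_{\mathcal{P}}G':p[P_h]\parallel N\parallel M$, then $H\vdash_{\mathcal{P}} G : p[P]\parallel N\parallel (q,\lambda_h,p)\cdot M$. We write $\vdash_{\mathcal{P}} G:N\parallel M$ when the judgement is derivable with empty history.
   Formalization: In rule (In) the history is extended with the session of the conclusion, whose queue still holds the message being read, not the queue after the read; otherwise G = pq?λ.G would type p[P] ∥ (q,λ,p) with P = q?λ.P, which gets stuck after one step. *)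

theory Defs
  imports Main "HOL-Library.Finite_Map" "HOL-Library.Extended_Nat"
begin

section \<open>Processes\<close>

text \<open>A family \<open>{\<lambda>\<^sub>i.P\<^sub>i}\<close> indexed by a finite set, with pairwise distinct labels, is a finite map from
  labels to continuations. Nonemptiness and regularity are imposed by \<open>wf_proc\<close>.\<close>

codatatype ('p, 'l) proc =
    Inact
  | Send 'p "('l, ('p, 'l) proc) fmap"
  | Recv 'p "('l, ('p, 'l) proc) fmap"

inductive subproc :: "('p, 'l) proc \<Rightarrow> ('p, 'l) proc \<Rightarrow> bool" where
  subproc_refl: "subproc P P"
| subproc_Send: "subproc Q P \<Longrightarrow> fmlookup Ps l = Some P \<Longrightarrow> subproc Q (Send q Ps)"
| subproc_Recv: "subproc Q P \<Longrightarrow> fmlookup Ps l = Some P \<Longrightarrow> subproc Q (Recv q Ps)"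

definition wf_proc :: "('p, 'l) proc \<Rightarrow> bool" where
  "wf_proc P \<longleftrightarrow> finite {Q. subproc Q P} \<and>
     (\<forall>q Ps. subproc (Send q Ps) P \<or> subproc (Recv q Ps) P \<longrightarrow> Ps \<noteq> fmempty)"

inductive in_plays :: "'p \<Rightarrow> ('p, 'l) proc \<Rightarrow> bool" where
  "in_plays q (Send q Ps)"
| "in_plays q (Recv q Ps)"
| "in_plays r P \<Longrightarrow> fmlookup Ps l = Some P \<Longrightarrow> in_plays r (Send q Ps)"
| "in_plays r P \<Longrightarrow> fmlookup Ps l = Some P \<Longrightarrow> in_plays r (Recv q Ps)"

definition plays :: "('p, 'l) proc \<Rightarrow> 'p set" where
  "plays P = {q. in_plays q P}"

lemma plays_simps:
  "plays Inact = {}"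
  "plays (Send q Ps) = {q} \<union> (\<Union>P \<in> fmran' Ps. plays P)"
  "plays (Recv q Ps) = {q} \<union> (\<Union>P \<in> fmran' Ps. plays P)"
  unfolding plays_def
  by (subst in_plays.simps, force simp: fmlookup_ran'_iff)+


section \<open>Queues\<close>

text \<open>Messages are triples \<open>(sender, label, receiver)\<close>.\<close>

type_synonym ('p, 'l) message = "'p \<times> 'l \<times> 'p"

inductive qswap :: "('p, 'l) message list \<Rightarrow> ('p, 'l) message list \<Rightarrow> bool" where
  "p \<noteq> r \<or> q \<noteq> s \<Longrightarrow>
     qswap (xs @ [(p, l, q), (r, l', s)] @ ys) (xs @ [(r, l', s), (p, l, q)] @ ys)"

quotient_type ('p, 'l) queue = "('p, 'l) message list" / "equivclp qswap"
  by (rule equivp_evquivclp)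

lemma qswap_append_left: "qswap xs ys \<Longrightarrow> qswap (zs @ xs) (zs @ ys)"
proof (induction rule: qswap.induct)
  case (1 p r q s xs l l' ys)
  then show ?case using qswap.intros[of p r q s "zs @ xs" l l' ys] by simp
qed

lemma qswap_append_right: "qswap xs ys \<Longrightarrow> qswap (xs @ zs) (ys @ zs)"
proof (induction rule: qswap.induct)
  case (1 p r q s xs l l' ys)
  then show ?case using qswap.intros[of p r q s xs l l' "ys @ zs"] by simp
qed

lemma equivclp_qswap_append_left:
  "equivclp qswap xs ys \<Longrightarrow> equivclp qswap (zs @ xs) (zs @ ys)"
  unfolding equivclp_def
  by (induction rule: rtranclp_induct)
     (simp, metis (no_types) rtranclp.rtrancl_into_rtrancl symclp_def qswap_append_left)

lemma equivclp_qswap_append_right: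
  "equivclp qswap xs ys \<Longrightarrow> equivclp qswap (xs @ zs) (ys @ zs)"
  unfolding equivclp_def
  by (induction rule: rtranclp_induct)
     (simp, metis (no_types) rtranclp.rtrancl_into_rtrancl symclp_def qswap_append_right)

lemma equivclp_qswap_set: "equivclp qswap xs ys \<Longrightarrow> set xs = set ys"
  unfolding equivclp_def
  by (induction rule: rtranclp_induct) (simp, force simp: symclp_def elim: qswap.cases)

lift_definition qempty :: "('p, 'l) queue" is "[]" .

lift_definition qsingle :: "('p, 'l) message \<Rightarrow> ('p, 'l) queue" is "\<lambda>m. [m]" .

lift_definition qappend :: "('p, 'l) queue \<Rightarrow> ('p, 'l) queue \<Rightarrow> ('p, 'l) queue" (infixr "\<cdot>" 65)
  is "(@)"
  by (rule equivclp_trans[OF equivclp_qswap_append_right equivclp_qswap_append_left])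

lift_definition qmsgs :: "('p, 'l) queue \<Rightarrow> ('p, 'l) message set" is set
  by (rule equivclp_qswap_set)


section \<open>Networks and sessions\<close>

text \<open>A parallel composition of located processes with distinct locations, modulo permutation and
  components \<open>p[0]\<close>, is a finitely supported function from participants to processes. The
  composition \<open>p[P] \<parallel> N\<close> is \<open>N(p := P)\<close> where \<open>N p = Inact\<close>.\<close>

type_synonym ('p, 'l) net = "'p \<Rightarrow> ('p, 'l) proc"

definition network :: "('p, 'l) net \<Rightarrow> bool" where
  "network N \<longleftrightarrow> finite {p. N p \<noteq> Inact} \<and> (\<forall>p. wf_proc (N p) \<and> p \<notin> plays (N p))"

definition located_in :: "'p \<Rightarrow> ('p, 'l) proc \<Rightarrow> ('p, 'l) net \<Rightarrow> bool" where
  "located_in p P N \<longleftrightarrow> P \<noteq> Inact \<and> (\<exists>N'. N' p = Inact \<and> N = N'(p := P))"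

definition Plays_net :: "('p, 'l) net \<Rightarrow> 'p set" where
  "Plays_net N = {p. \<exists>P. located_in p P N}"

type_synonym ('p, 'l) session = "('p, 'l) net \<times> ('p, 'l) queue"

text \<open>\<open>COut p q l\<close>: \<open>p\<close> sends \<open>l\<close> to \<open>q\<close>; \<open>CIn p q l\<close>: \<open>p\<close> reads \<open>l\<close> sent by \<open>q\<close>.\<close>

datatype ('p, 'l) comm = COut 'p 'p 'l | CIn 'p 'p 'l

fun play :: "('p, 'l) comm \<Rightarrow> 'p" where
  "play (COut p q l) = p"
| "play (CIn p q l) = p"

inductive step :: "('p, 'l) session \<Rightarrow> ('p, 'l) comm \<Rightarrow> ('p, 'l) session \<Rightarrow> bool" where
  step_Send: "N p = Inact \<Longrightarrow> fmlookup Ps l = Some P \<Longrightarrow>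
    step (N(p := Send q Ps), M) (COut p q l) (N(p := P), M \<cdot> qsingle (p, l, q))"
| step_Rcv: "N p = Inact \<Longrightarrow> fmlookup Ps l = Some P \<Longrightarrow>
    step (N(p := Recv q Ps), qsingle (q, l, p) \<cdot> M) (CIn p q l) (N(p := P), M)"

inductive steps :: "('p, 'l) session \<Rightarrow> ('p, 'l) comm list \<Rightarrow> ('p, 'l) session \<Rightarrow> bool" where
  steps_Nil: "steps S [] S"
| steps_Cons: "step S \<beta> S' \<Longrightarrow> steps S' \<tau> S'' \<Longrightarrow> steps S (\<beta> # \<tau>) S''"

definition lock_free_at :: "'p \<Rightarrow> ('p, 'l) session \<Rightarrow> bool" where
  "lock_free_at p S \<longleftrightarrow>
     (\<forall>\<tau> N' M' P. steps S \<tau> (N', M') \<longrightarrow> located_in p P N' \<longrightarrow>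
        (\<exists>\<tau>' \<beta> S''. play \<beta> = p \<and> steps (N', M') (\<tau>' @ [\<beta>]) S''))"

definition lock_free :: "'p set \<Rightarrow> ('p, 'l) session \<Rightarrow> bool" where
  "lock_free \<P> S \<longleftrightarrow> (\<forall>p \<in> \<P>. lock_free_at p S)"


section \<open>Global types\<close>

text \<open>\<open>GIn p q l G\<close> is \<open>pq?l.G\<close>, with reader \<open>p\<close> and sender \<open>q\<close>.\<close>

codatatype ('p, 'l) gtype =
    GOut 'p 'p "('l, ('p, 'l) gtype) fmap"
  | GIn 'p 'p 'l "('p, 'l) gtype"
  | GEnd

inductive subgtype :: "('p, 'l) gtype \<Rightarrow> ('p, 'l) gtype \<Rightarrow> bool" where
  subgtype_refl: "subgtype G G"
| subgtype_GOut: "subgtype G' G \<Longrightarrow> fmlookup Gs l = Some G \<Longrightarrow> subgtype G' (GOut p q Gs)"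
| subgtype_GIn: "subgtype G' G \<Longrightarrow> subgtype G' (GIn p q l G)"

definition wf_gtype :: "('p, 'l) gtype \<Rightarrow> bool" where
  "wf_gtype G \<longleftrightarrow> finite {G'. subgtype G' G} \<and>
     (\<forall>p q Gs. subgtype (GOut p q Gs) G \<longrightarrow> p \<noteq> q \<and> Gs \<noteq> fmempty) \<and>
     (\<forall>p q l G'. subgtype (GIn p q l G') G \<longrightarrow> p \<noteq> q)"

inductive in_Plays_gtype :: "'p \<Rightarrow> ('p, 'l) gtype \<Rightarrow> bool" where
  "in_Plays_gtype p (GOut p q Gs)"
| "in_Plays_gtype p (GIn p q l G)"
| "in_Plays_gtype r G \<Longrightarrow> fmlookup Gs l = Some G \<Longrightarrow> in_Plays_gtype r (GOut p q Gs)"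
| "in_Plays_gtype r G \<Longrightarrow> in_Plays_gtype r (GIn p q l G)"

definition Plays_gtype :: "('p, 'l) gtype \<Rightarrow> 'p set" where
  "Plays_gtype G = {p. in_Plays_gtype p G}"

lemma Plays_gtype_simps:
  "Plays_gtype GEnd = {}"
  "Plays_gtype (GOut p q Gs) = {p} \<union> (\<Union>G \<in> fmran' Gs. Plays_gtype G)"
  "Plays_gtype (GIn p q l G) = {p} \<union> Plays_gtype G"
  unfolding Plays_gtype_def
  by (subst in_Plays_gtype.simps, force simp: fmlookup_ran'_iff)+


subsection \<open>Paths, depth and boundedness\<close>

text \<open>Finite or infinite sequences.\<close>

codatatype 'a llist = LNil | LCons 'a "'a llist"

primrec lnth :: "nat \<Rightarrow> 'a llist \<Rightarrow> 'a option" where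
  "lnth 0 \<xi> = (case \<xi> of LNil \<Rightarrow> None | LCons x _ \<Rightarrow> Some x)"
| "lnth (Suc n) \<xi> = (case \<xi> of LNil \<Rightarrow> None | LCons _ \<xi>' \<Rightarrow> lnth n \<xi>')"

coinductive is_path :: "('p, 'l) gtype \<Rightarrow> ('p, 'l) comm llist \<Rightarrow> bool" where
  "is_path GEnd LNil"
| "fmlookup Gs l = Some G \<Longrightarrow> is_path G \<xi> \<Longrightarrow> is_path (GOut p q Gs) (LCons (COut p q l) \<xi>)"
| "is_path G \<xi> \<Longrightarrow> is_path (GIn p q l G) (LCons (CIn p q l) \<xi>)"

definition Paths :: "('p, 'l) gtype \<Rightarrow> ('p, 'l) comm llist set" where
  "Paths G = {\<xi>. is_path G \<xi>}"

text \<open>Positions on a path are counted from 1, whereas \<open>lnth\<close> counts from 0. In \<open>enat\<close> the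
  infimum of the empty set is \<open>\<infinity>\<close>.\<close>

definition depth_path :: "('p, 'l) comm llist \<Rightarrow> 'p \<Rightarrow> enat" where
  "depth_path \<xi> p = Inf {enat (Suc n) | n. \<exists>\<beta>. lnth n \<xi> = Some \<beta> \<and> play \<beta> = p}"

definition depth :: "('p, 'l) gtype \<Rightarrow> 'p \<Rightarrow> enat" where
  "depth G p = (if p \<in> Plays_gtype G then (SUP \<xi> \<in> Paths G. depth_path \<xi> p) else 0)"

definition bounded_gtype :: "('p, 'l) gtype \<Rightarrow> bool" where
  "bounded_gtype G \<longleftrightarrow>
     (\<forall>p \<in> Plays_gtype G. \<forall>G'. subgtype G' G \<longrightarrow> depth G' p \<noteq> \<infinity>)"


subsection \<open>Weight and soundness\<close>

text \<open>The recursive equations for the weight have exactly one solution in \<open>enat\<close>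
  (lemmas \<open>wg_simps\<close> and \<open>wg_unique\<close>); it is obtained here as the least one.\<close>

fun wg_step :: "('p, 'l) message \<Rightarrow> (('p, 'l) gtype \<Rightarrow> enat) \<Rightarrow> ('p, 'l) gtype \<Rightarrow> enat" where
  "wg_step (p, l, q) w G =
     (case G of
        GEnd \<Rightarrow> \<infinity>
      | GOut r s Gs \<Rightarrow> 1 + (SUP G' \<in> fmran' Gs. w G')
      | GIn r s l' G' \<Rightarrow>
          if r = q \<and> s = p then (if l' = l then 0 else \<infinity>) else 1 + w G')"

definition wg :: "('p, 'l) message \<Rightarrow> ('p, 'l) gtype \<Rightarrow> enat" where
  "wg m = lfp (wg_step m)"

lemma mono_wg_step: "mono (wg_step m)"
proof (rule monoI, rule le_funI)
  fix v w :: "('a, 'b) gtype \<Rightarrow> enat" and G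
  assume vw: "v \<le> w"
  have "(SUP G' \<in> A. v G') \<le> (SUP G' \<in> A. w G')" for A
    by (rule SUP_mono') (use vw in \<open>auto simp: le_fun_def\<close>)
  then show "wg_step m v G \<le> wg_step m w G"
    using vw by (cases m) (auto simp: le_fun_def split: gtype.split intro: add_left_mono)
qed

lemma wg_fixpoint: "wg_step m (wg m) = wg m"
  unfolding wg_def by (rule lfp_unfold[OF mono_wg_step, symmetric])

lemma wg_simps:
  "wg (p, l, q) GEnd = \<infinity>"
  "wg (p, l, q) (GIn q p l G) = 0"
  "l' \<noteq> l \<Longrightarrow> wg (p, l, q) (GIn q p l' G) = \<infinity>"
  "r \<noteq> q \<or> s \<noteq> p \<Longrightarrow> wg (p, l, q) (GIn r s l' G) = 1 + wg (p, l, q) G"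
  "wg (p, l, q) (GOut r s Gs) = 1 + (SUP G \<in> fmran' Gs. wg (p, l, q) G)"
  using wg_fixpoint[of "(p, l, q)", THEN fun_cong, symmetric] by auto

lemma wg_step_fixpoints_agree:
  assumes v: "wg_step m v = v" and w: "wg_step m w = w"
  shows "v G = enat n \<Longrightarrow> w G = enat n"
proof (induction n arbitrary: G rule: less_induct)
  case (less n)
  obtain p l q where m: "m = (p, l, q)" by (cases m) auto
  have vG: "v G = wg_step m v G" and wG: "w G = wg_step m w G" using v w by simp_all
  show ?case
  proof (cases G)
    case (GOut r s Gs)
    have e: "enat n = 1 + (SUP G' \<in> fmran' Gs. v G')" using less.prems vG GOut m by simp
    have "w G' = v G'" if G': "G' \<in> fmran' Gs" for G'
    proof -
      have "v G' \<le> (SUP G' \<in> fmran' Gs. v G')" using G' by (rule SUP_upper)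
      then have "1 + v G' \<le> enat n" unfolding e by (rule add_left_mono)
      then obtain k where "v G' = enat k" "k < n"
        by (cases "v G'") (auto simp: one_enat_def)
      then show ?thesis using less.IH by simp
    qed
    then have "(SUP G' \<in> fmran' Gs. w G') = (SUP G' \<in> fmran' Gs. v G')" by simp
    then show ?thesis using wG GOut m e by simp
  next
    case (GIn r s l' G')
    show ?thesis
    proof (cases "r = q \<and> s = p")
      case True
      then show ?thesis using vG wG GIn m less.prems by simp
    next
      case False
      then have e: "enat n = 1 + v G'" using less.prems vG GIn m by auto
      then obtain k where "v G' = enat k" "k < n"
        by (cases "v G'") (auto simp: one_enat_def)
      then show ?thesis using less.IH e wG GIn m False by auto
    qed
  next
    case GEnd
    then show ?thesis using vG m less.prems by simp
  qed
qed

lemma wg_unique: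
  assumes "wg_step m w = w"
  shows "w = wg m"
proof
  fix G
  show "w G = wg m G"
    using wg_step_fixpoints_agree[OF assms wg_fixpoint, of G]
      wg_step_fixpoints_agree[OF wg_fixpoint assms, of G]
    by (cases "w G"; cases "wg m G") auto
qed

definition sound :: "'p set \<Rightarrow> ('p, 'l) gtype \<Rightarrow> ('p, 'l) queue \<Rightarrow> bool" where
  "sound \<P> G M \<longleftrightarrow>
     (\<forall>p l q. (p, l, q) \<in> qmsgs M \<longrightarrow> {p, q} \<subseteq> \<P> \<longrightarrow> wg (p, l, q) G \<noteq> \<infinity>)"


section \<open>Typing\<close>

type_synonym ('p, 'l) history = "(('p, 'l) session \<times> ('p, 'l) gtype) set"

text \<open>\<open>typed \<P> H G (N, M)\<close> is the judgement \<open>H \<turnstile>\<^sub>\<P> G : N \<parallel> M\<close>. In both \<open>typed_Out\<close> and \<open>typed_In\<close>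
  the history is extended with the session and global type of the conclusion. For \<open>typed_In\<close> this
  means the queue that still contains the message being read: if the queue after the read were
  recorded instead, \<open>G = pq?l.G\<close> would type \<open>p[P] \<parallel> (q,l,p)\<close> with \<open>P = q?l.P\<close> by one \<open>In\<close> and one
  \<open>Cycle\<close>, although that session is stuck after a single step.\<close>

inductive typed ::
    "'p set \<Rightarrow> ('p, 'l) history \<Rightarrow> ('p, 'l) gtype \<Rightarrow> ('p, 'l) session \<Rightarrow> bool"
  for \<P> :: "'p set" where
  typed_End:
    "Plays_net N \<inter> \<P> = {} \<Longrightarrow> sound \<P> GEnd M \<Longrightarrow> typed \<P> H GEnd (N, M)"
| typed_Cycle:
    "((N, M), G) \<in> H \<Longrightarrow> typed \<P> H G (N, M)"
| typed_Out:
    "\<lbrakk> G = GOut p q Gs; P = Send q Ps; fmdom' Gs = fmdom' Ps; N p = Inact;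
       sound \<P> G M;
       \<forall>M'. ((N(p := P), M'), G) \<notin> H;
       (Plays_net N - Plays_gtype G) \<inter> \<P> = {};
       \<forall>l G\<^sub>l P\<^sub>l. fmlookup Gs l = Some G\<^sub>l \<longrightarrow> fmlookup Ps l = Some P\<^sub>l \<longrightarrow>
         typed \<P> (insert ((N(p := P), M), G) H) G\<^sub>l (N(p := P\<^sub>l), M \<cdot> qsingle (p, l, q)) \<rbrakk>
     \<Longrightarrow> typed \<P> H G (N(p := P), M)"
| typed_In:
    "\<lbrakk> G = GIn p q l G'; P = Recv q Ps; fmlookup Ps l = Some P\<^sub>l; N p = Inact;
       sound \<P> G' M;
       \<forall>M'. ((N(p := P), M'), G) \<notin> H;
       (Plays_net N - Plays_gtype G) \<inter> \<P> = {};
       typed \<P> (insert ((N(p := P), qsingle (q, l, p) \<cdot> M), G) H) G' (N(p := P\<^sub>l), M) \<rbrakk>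
     \<Longrightarrow> typed \<P> H G (N(p := P), qsingle (q, l, p) \<cdot> M)"

end

theory Submission
  imports Defs
begin

text \<open>A derivation with empty history unfolds along the cycles into a coinductive invariant
  \<open>follows\<close>: the session can always perform the communication at the root of the global type, every
  move of the player at that root leads to a session following a branch, and by boundedness every
  active participant of \<open>\<P>\<close> eventually comes to the root. Let \<open>S\<close> follow \<open>G\<close>, let \<open>S\<close> reach
  \<open>S'\<close> by \<open>\<tau>\<close>, and let \<open>s\<close> be the player at the root of \<open>G\<close>. If \<open>s\<close> moves in \<open>\<tau>\<close>, its first move
  commutes to the front, which leaves a shorter trace from a session following a branch of \<open>G\<close>.
  Otherwise \<open>S'\<close> can still perform the root communication, which commutes with \<open>\<tau>\<close>, and the distance
  of \<open>p\<close> to the root decreases. Hence \<open>p\<close> can move after \<open>S'\<close>, by lexicographic induction, and no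
  subject reduction for global types is needed.\<close>

section \<open>Queues\<close>

text \<open>Adjacent messages may be exchanged exactly when these pairs differ: the pair is the
  channel on which the order of messages is kept.\<close>

fun chan :: "('p, 'l) message \<Rightarrow> 'p \<times> 'p" where
  "chan (p, l, q) = (p, q)"

lemma qswap_adjacent:
  assumes "chan x \<noteq> chan y"
  shows "qswap (x # y # zs) (y # x # zs)"
proof -
  obtain p l q where x: "x = (p, l, q)" by (cases x)
  obtain r l' s where y: "y = (r, l', s)" by (cases y)
  have "p \<noteq> r \<or> q \<noteq> s" using assms x y by auto
  from qswap.intros[OF this, of "[]" l l' zs] show ?thesis using x y by simp
qed

lemma equivclp_qswap_Cons:
  "equivclp qswap xs ys \<Longrightarrow> equivclp qswap (x # xs) (x # ys)"
  using equivclp_qswap_append_left[of xs ys "[x]"] by simp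

lemma equivclp_qswap_to_front:
  "\<forall>y \<in> set ys. chan y \<noteq> chan x \<Longrightarrow> equivclp qswap (ys @ x # zs) (x # ys @ zs)"
proof (induction ys)
  case Nil
  then show ?case by simp
next
  case (Cons y ys)
  then have "equivclp qswap (y # ys @ x # zs) (y # x # ys @ zs)"
    by (intro equivclp_qswap_Cons) simp
  also have "equivclp qswap (y # x # ys @ zs) (x # y # ys @ zs)"
    using Cons.prems by (intro r_into_equivclp qswap_adjacent) simp
  finally show ?case by simp
qed

lemma qswap_filter_chan:
  "qswap xs ys \<Longrightarrow> filter (\<lambda>m. chan m = c) xs = filter (\<lambda>m. chan m = c) ys"
  by (induction rule: qswap.induct) auto

lemma equivclp_qswap_filter_chan:
  "equivclp qswap xs ys \<Longrightarrow> filter (\<lambda>m. chan m = c) xs = filter (\<lambda>m. chan m = c) ys"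
proof (induction rule: equivclp_induct)
  case base
  show ?case ..
next
  case (step y z)
  then show ?case using qswap_filter_chan by metis
qed

lemma split_first_on_chan:
  assumes "filter (\<lambda>m. chan m = chan x) ys = x # zs"
  obtains us vs where "ys = us @ x # vs" "\<forall>u \<in> set us. chan u \<noteq> chan x"
  using assms by (auto simp: filter_eq_Cons_iff)

text \<open>An exchange changes the word of no channel. Conversely, the head \<open>x\<close> of
  \<open>xs\<close> is the first message of its channel in \<open>ys\<close>, so it moves to the
  front there, and induction treats the rest. Equations between queues thus become equations between
  lists.\<close>

lemma equivclp_qswap_iff:
  "equivclp qswap xs ys \<longleftrightarrow>
     (\<forall>c. filter (\<lambda>m. chan m = c) xs = filter (\<lambda>m. chan m = c) ys)"
proof
  assume "equivclp qswap xs ys"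
  then show "\<forall>c. filter (\<lambda>m. chan m = c) xs = filter (\<lambda>m. chan m = c) ys"
    using equivclp_qswap_filter_chan by blast
next
  assume "\<forall>c. filter (\<lambda>m. chan m = c) xs = filter (\<lambda>m. chan m = c) ys"
  then show "equivclp qswap xs ys"
  proof (induction xs arbitrary: ys)
    case Nil
    have "y \<notin> set ys" for y
      using Nil[rule_format, of "chan y"] by (auto simp: filter_empty_conv dest!: sym[of "[]"])
    then have "ys = []" by (cases ys) auto
    then show ?case by simp
  next
    case (Cons x xs)
    have "filter (\<lambda>m. chan m = chan x) ys = x # filter (\<lambda>m. chan m = chan x) xs"
      using Cons.prems[rule_format, of "chan x"] by simp
    then obtain us vs where ys: "ys = us @ x # vs" and us: "\<forall>u \<in> set us. chan u \<noteq> chan x"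
      by (rule split_first_on_chan)
    have front: "equivclp qswap ys (x # us @ vs)"
      unfolding ys by (rule equivclp_qswap_to_front[OF us])
    have "filter (\<lambda>m. chan m = c) xs = filter (\<lambda>m. chan m = c) (us @ vs)" for c
      using Cons.prems[rule_format, of c] equivclp_qswap_filter_chan[OF front, of c]
      by (auto split: if_splits)
    then have "equivclp qswap (x # xs) (x # us @ vs)"
      by (intro equivclp_qswap_Cons Cons.IH) blast
    then show ?case using front equivclp_sym equivclp_trans by metis
  qed
qed

section \<open>Cancellation and exchange at the front of a queue\<close>

lemma qappend_assoc: "(M \<cdot> M') \<cdot> M'' = M \<cdot> (M' \<cdot> M'')"
  by transfer simp

lemma qsingle_commute:
  "chan m \<noteq> chan m' \<Longrightarrow> qsingle m \<cdot> qsingle m' = qsingle m' \<cdot> qsingle m"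
  by transfer (simp add: r_into_equivclp qswap_adjacent)

lemma qsingle_qappend_cancel:
  "qsingle m \<cdot> M = qsingle m' \<cdot> M' \<Longrightarrow> chan m = chan m' \<Longrightarrow> m = m' \<and> M = M'"
proof transfer
  fix m m' :: "('a, 'b) message" and xs ys
  assume "equivclp qswap ([m] @ xs) ([m'] @ ys)" and c: "chan m = chan m'"
  then have eq: "filter (\<lambda>m. chan m = c) (m # xs) = filter (\<lambda>m. chan m = c) (m' # ys)" for c
    using equivclp_qswap_filter_chan[of "[m] @ xs" "[m'] @ ys" c] by simp
  have "m = m'" using eq[of "chan m"] c by simp
  moreover have "filter (\<lambda>m. chan m = c) xs = filter (\<lambda>m. chan m = c) ys" for c
    using eq[of c] c by (auto split: if_splits)
  ultimately show "m = m' \<and> equivclp qswap xs ys" by (simp add: equivclp_qswap_iff)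
qed

text \<open>Removing \<open>m\<close> leaves the channel of \<open>m'\<close> intact, so
  \<open>m'\<close> is still first on it in \<open>M\<close> and moves to the front. Cancelling
  \<open>m'\<close> then gives the form of \<open>M'\<close>.\<close>

lemma qsingle_qappend_diamond:
  assumes "qsingle m \<cdot> M = qsingle m' \<cdot> M'" and ne: "chan m \<noteq> chan m'"
  obtains M'' where "M = qsingle m' \<cdot> M''" "M' = qsingle m \<cdot> M''"
proof -
  have "\<exists>M''. M = qsingle m' \<cdot> M''" using assms
  proof transfer
    fix m m' :: "('a, 'b) message" and xs ys
    assume "equivclp qswap ([m] @ xs) ([m'] @ ys)" and "chan m \<noteq> chan m'"
    then have "filter (\<lambda>x. chan x = chan m') xs = m' # filter (\<lambda>x. chan x = chan m') ys"
      using equivclp_qswap_filter_chan[of "[m] @ xs" "[m'] @ ys" "chan m'"] by auto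
    then obtain us vs where "xs = us @ m' # vs" "\<forall>u \<in> set us. chan u \<noteq> chan m'"
      by (rule split_first_on_chan)
    then have "equivclp qswap xs ([m'] @ (us @ vs))" by (simp add: equivclp_qswap_to_front)
    then show "\<exists>zs. equivclp qswap xs ([m'] @ zs)" by blast
  qed
  then obtain M'' where M: "M = qsingle m' \<cdot> M''" by blast
  have "qsingle m' \<cdot> M' = qsingle m \<cdot> (qsingle m' \<cdot> M'')" using assms M by simp
  also have "\<dots> = qsingle m' \<cdot> (qsingle m \<cdot> M'')"
    using qsingle_commute[OF ne] by (simp flip: qappend_assoc)
  finally have "M' = qsingle m \<cdot> M''" using qsingle_qappend_cancel by blast
  then show thesis using M that by blast
qed


section \<open>Commutation of transitions\<close>

text \<open>Reading the process off as \<open>N p\<close>, instead of matching the network against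
  \<open>N(p := ...)\<close>, allows two transitions from one network to be compared by
  simplification.\<close>

lemma step_iff:
  "step (N, M) \<beta> (N', M') \<longleftrightarrow>
     (\<exists>p q l Ps P. \<beta> = COut p q l \<and> N p = Send q Ps \<and> fmlookup Ps l = Some P \<and>
        N' = N(p := P) \<and> M' = M \<cdot> qsingle (p, l, q)) \<or>
     (\<exists>p q l Ps P. \<beta> = CIn p q l \<and> N p = Recv q Ps \<and> fmlookup Ps l = Some P \<and>
        N' = N(p := P) \<and> M = qsingle (q, l, p) \<cdot> M')" (is "_ \<longleftrightarrow> ?out \<or> ?in")
proof
  assume "step (N, M) \<beta> (N', M')"
  then show "?out \<or> ?in" by cases auto
next
  assume "?out \<or> ?in"
  then show "step (N, M) \<beta> (N', M')"
  proof
    assume ?out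
    then obtain p q l Ps P where "\<beta> = COut p q l" "N p = Send q Ps" "fmlookup Ps l = Some P"
      "N' = N(p := P)" "M' = M \<cdot> qsingle (p, l, q)" by blast
    then show ?thesis
      using step_Send[of "N(p := Inact)" p Ps l P q M] by (simp add: fun_upd_idem)
  next
    assume ?in
    then obtain p q l Ps P where "\<beta> = CIn p q l" "N p = Recv q Ps" "fmlookup Ps l = Some P"
      "N' = N(p := P)" "M = qsingle (q, l, p) \<cdot> M'" by blast
    then show ?thesis
      using step_Rcv[of "N(p := Inact)" p Ps l P q M'] by (simp add: fun_upd_idem)
  qed
qed

lemma step_other: "step S \<beta> S' \<Longrightarrow> r \<noteq> play \<beta> \<Longrightarrow> fst S' r = fst S r"
  by (induction rule: step.induct) auto

lemma step_active: "step S \<beta> S' \<Longrightarrow> fst S (play \<beta>) \<noteq> Inact"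
  by (induction rule: step.induct) auto

lemma step_deterministic: "step S \<beta> S' \<Longrightarrow> step S \<beta> S'' \<Longrightarrow> S' = S''"
  by (cases S; cases S'; cases S'') (auto simp: step_iff dest: qsingle_qappend_cancel)

text \<open>Different players change different locations. In the queue, two sends use channels with
  different senders, two reads use channels with different receivers, and a send and a read act at
  opposite ends.\<close>

lemma step_diamond:
  assumes "step S \<alpha> S1" "step S \<beta> S2" "play \<alpha> \<noteq> play \<beta>"
  shows "\<exists>S3. step S1 \<beta> S3 \<and> step S2 \<alpha> S3"
proof -
  obtain N M where S: "S = (N, M)" by (cases S)
  obtain N1 M1 where S1: "S1 = (N1, M1)" by (cases S1)
  obtain N2 M2 where S2: "S2 = (N2, M2)" by (cases S2)
  have a: "step (N, M) \<alpha> (N1, M1)" and b: "step (N, M) \<beta> (N2, M2)"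
    using assms S S1 S2 by auto
  define N3 where "N3 = N1(play \<beta> := N2 (play \<beta>))"
  have *: "\<exists>M3. step (N1, M1) \<beta> (N3, M3) \<and> step (N2, M2) \<alpha> (N3, M3)"
  proof (cases \<alpha>)
    case (COut p q l)
    show ?thesis
    proof (cases \<beta>)
      case (COut r s l')
      have "qsingle (p, l, q) \<cdot> qsingle (r, l', s) = qsingle (r, l', s) \<cdot> qsingle (p, l, q)"
        using assms(3) \<open>\<alpha> = _\<close> COut by (intro qsingle_commute) auto
      then have "(M \<cdot> qsingle (p, l, q)) \<cdot> qsingle (r, l', s) =
          (M \<cdot> qsingle (r, l', s)) \<cdot> qsingle (p, l, q)"
        by (simp only: qappend_assoc)
      then show ?thesis using a b assms(3) \<open>\<alpha> = _\<close> COut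
        by (auto simp: step_iff N3_def fun_upd_twist)
    next
      case (CIn r s l')
      then show ?thesis using a b assms(3) COut
        by (auto simp: step_iff N3_def qappend_assoc fun_upd_twist)
    qed
  next
    case (CIn p q l)
    show ?thesis
    proof (cases \<beta>)
      case (COut r s l')
      then show ?thesis using a b assms(3) CIn
        by (auto simp: step_iff N3_def qappend_assoc fun_upd_twist)
    next
      case (CIn r s l')
      have "qsingle (q, l, p) \<cdot> M1 = qsingle (s, l', r) \<cdot> M2"
        using a b \<open>\<alpha> = _\<close> CIn by (auto simp: step_iff)
      then obtain M3 where "M1 = qsingle (s, l', r) \<cdot> M3" "M2 = qsingle (q, l, p) \<cdot> M3"
        using assms(3) \<open>\<alpha> = _\<close> CIn by (elim qsingle_qappend_diamond) auto
      then show ?thesis using a b assms(3) \<open>\<alpha> = _\<close> CIn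
        by (auto simp: step_iff N3_def fun_upd_twist)
    qed
  qed
  then show ?thesis using S1 S2 by blast
qed

text \<open>Without the third premise \<open>\<beta>\<close> could be the reception of a message sent by \<open>\<alpha>\<close>.\<close>

lemma step_pull_forward:
  assumes "step S \<alpha> S1" "step S1 \<beta> S2" "step S \<beta>' S'" "play \<beta>' = play \<beta>" "play \<alpha> \<noteq> play \<beta>"
  shows "\<exists>S3. step S \<beta> S3 \<and> step S3 \<alpha> S2"
proof -
  have "\<exists>S3. step S \<beta> S3"
  proof (cases \<beta>)
    case (COut p q l)
    have "fst S1 p = fst S p" using step_other[OF assms(1)] assms(5) COut by simp
    then show ?thesis using assms(2) COut
      by (cases S; cases S1; cases S2) (auto simp: step_iff)
  next
    case (CIn p q l)
    \<comment> \<open>\<open>\<beta>'\<close> survives \<alpha>. At \<open>S1\<close>, both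
      \<open>\<beta>'\<close> and \<beta> are reads by one process from one fixed sender, and the
      first message on that channel is unique.\<close>
    obtain S3 where S3: "step S1 \<beta>' S3"
      using step_diamond[OF assms(1,3)] assms(4,5) by auto
    have "\<beta>' = \<beta>"
      using assms(2,4) S3 CIn
      by (cases S1; cases S2; cases S3) (auto simp: step_iff dest: qsingle_qappend_cancel)
    then show ?thesis using assms(3) by blast
  qed
  then obtain S3 where S3: "step S \<beta> S3" by blast
  with step_diamond[OF assms(1) S3 assms(5)] step_deterministic[OF assms(2)] show ?thesis
    by blast
qed

section \<open>Commutation along traces\<close>

lemma steps_Nil_iff: "steps S [] S' \<longleftrightarrow> S' = S"
  by (subst steps.simps) auto

lemma steps_Cons_iff: "steps S (\<beta> # \<tau>) S'' \<longleftrightarrow> (\<exists>S'. step S \<beta> S' \<and> steps S' \<tau> S'')"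
  by (subst steps.simps) auto

lemma steps_append_iff: "steps S (\<tau> @ \<tau>') S'' \<longleftrightarrow> (\<exists>S'. steps S \<tau> S' \<and> steps S' \<tau>' S'')"
  by (induction \<tau> arbitrary: S) (auto simp: steps_Nil_iff steps_Cons_iff)

lemma steps_active: "steps S \<tau> S' \<Longrightarrow> fst S' p \<noteq> Inact \<Longrightarrow> fst S p \<noteq> Inact"
proof (induction rule: steps.induct)
  case (steps_Cons S \<beta> S' \<tau> S'')
  then show ?case using step_active step_other by metis
qed simp

lemma steps_diamond:
  assumes "steps S \<tau> S'" "step S \<beta> S1" "play \<beta> \<notin> play ` set \<tau>"
  shows "\<exists>S2. step S' \<beta> S2 \<and> steps S1 \<tau> S2"
  using assms
proof (induction arbitrary: S1 rule: steps.induct)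
  case (steps_Nil S)
  then show ?case using steps.steps_Nil by blast
next
  case (steps_Cons S \<alpha> S' \<tau> S'')
  then obtain S3 where "step S' \<beta> S3" "step S1 \<alpha> S3"
    using step_diamond[OF steps_Cons.hyps(1) steps_Cons.prems(1)] by auto
  moreover from steps_Cons.IH[OF this(1)] steps_Cons.prems
  obtain S2 where "step S'' \<beta> S2" "steps S3 \<tau> S2" by auto
  ultimately show ?case using steps.steps_Cons by blast
qed

lemma steps_pull_forward:
  assumes "steps S \<tau> S1" "step S1 \<beta> S2" "step S \<beta>' S'" "play \<beta>' = play \<beta>"
    "play \<beta> \<notin> play ` set \<tau>"
  shows "\<exists>S3. step S \<beta> S3 \<and> steps S3 \<tau> S2"
  using assms
proof (induction arbitrary: S' rule: steps.induct)
  case (steps_Nil S)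
  then show ?case using steps.steps_Nil by blast
next
  case (steps_Cons S \<alpha> Sa \<tau> S'')
  from steps_Cons.prems have ne: "play \<alpha> \<noteq> play \<beta>" by auto
  \<comment> \<open>The player of \<beta> does not move in \<alpha>, so \<open>\<beta>'\<close>
    stays enabled and the induction hypothesis applies at \<open>Sa\<close>.\<close>
  obtain S3 where "step Sa \<beta>' S3"
    using step_diamond[OF steps_Cons.hyps(1) steps_Cons.prems(2)] steps_Cons.prems by auto
  from steps_Cons.IH[OF steps_Cons.prems(1) this steps_Cons.prems(3)] steps_Cons.prems(4)
  obtain S4 where "step Sa \<beta> S4" "steps S4 \<tau> S2" by auto
  moreover from step_pull_forward[OF steps_Cons.hyps(1) this(1) steps_Cons.prems(2,3) ne]
  obtain S5 where "step S \<beta> S5" "step S5 \<alpha> S4" by blast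
  ultimately show ?case using steps.steps_Cons by blast
qed


section \<open>Boundedness\<close>

text \<open>Every path reaches a move of \<open>p\<close>, stated as a well-founded predicate.
  Induction on it replaces induction on the depth.\<close>

inductive bar :: "'p \<Rightarrow> ('p, 'l) gtype \<Rightarrow> bool" for p where
  bar_GOut_here: "bar p (GOut p q Gs)"
| bar_GIn_here: "bar p (GIn p q l G)"
| bar_GOut: "(\<And>l G. fmlookup Gs l = Some G \<Longrightarrow> bar p G) \<Longrightarrow> bar p (GOut r s Gs)"
| bar_GIn: "bar p G \<Longrightarrow> bar p (GIn r s l G)"

text \<open>If \<open>bar p G\<close> fails at a send, it fails in some branch, and the choice
  follows such a branch forever, as in Konig's lemma. The value is meaningful only when
  \<open>bar p G\<close> fails.\<close>

primcorec avoiding_path :: "'p \<Rightarrow> ('p, 'l) gtype \<Rightarrow> ('p, 'l) comm llist" where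
  "avoiding_path p G = (case G of
       GEnd \<Rightarrow> LNil
     | GOut r s Gs \<Rightarrow>
         LCons (COut r s (SOME l. \<exists>G'. fmlookup Gs l = Some G' \<and> \<not> bar p G'))
           (avoiding_path p (the (fmlookup Gs (SOME l. \<exists>G'. fmlookup Gs l = Some G' \<and> \<not> bar p G'))))
     | GIn r s l G' \<Rightarrow> LCons (CIn r s l) (avoiding_path p G'))"

lemma avoiding_path_GOut:
  assumes "\<not> bar p (GOut r s Gs)"
  obtains l G where "fmlookup Gs l = Some G" "\<not> bar p G"
    "avoiding_path p (GOut r s Gs) = LCons (COut r s l) (avoiding_path p G)"
proof -
  define l where "l = (SOME l. \<exists>G'. fmlookup Gs l = Some G' \<and> \<not> bar p G')"
  have "\<exists>l G'. fmlookup Gs l = Some G' \<and> \<not> bar p G'" using assms bar_GOut by metis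
  then have "\<exists>G'. fmlookup Gs l = Some G' \<and> \<not> bar p G'" unfolding l_def by (rule someI_ex)
  then obtain G where "fmlookup Gs l = Some G" "\<not> bar p G" by blast
  moreover from this have
    "avoiding_path p (GOut r s Gs) = LCons (COut r s l) (avoiding_path p G)"
    by (subst avoiding_path.code) (simp flip: l_def)
  ultimately show thesis by (rule that)
qed

lemma avoiding_path_GIn:
  "avoiding_path p (GIn r s l G) = LCons (CIn r s l) (avoiding_path p G)"
  by (subst avoiding_path.code) simp

lemma avoiding_path_GEnd: "avoiding_path p GEnd = LNil"
  by (subst avoiding_path.code) simp

lemma is_path_avoiding_path: "\<not> bar p G \<Longrightarrow> is_path G (avoiding_path p G)"
proof (coinduction arbitrary: G)
  case is_path
  show ?case
  proof (cases G)
    case (GOut r s Gs)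
    with is_path obtain l G' where "fmlookup Gs l = Some G'" "\<not> bar p G'"
      "avoiding_path p G = LCons (COut r s l) (avoiding_path p G')"
      by (metis avoiding_path_GOut)
    then show ?thesis using GOut by auto
  next
    case (GIn r s l G')
    moreover from this is_path have "\<not> bar p G'" using bar_GIn by metis
    ultimately show ?thesis by (auto simp: avoiding_path_GIn)
  next
    case GEnd
    then show ?thesis by (simp add: avoiding_path_GEnd)
  qed
qed

lemma avoiding_path_avoids:
  "\<not> bar p G \<Longrightarrow> lnth n (avoiding_path p G) = Some \<beta> \<Longrightarrow> play \<beta> \<noteq> p"
proof (induction n arbitrary: G)
  case 0
  show ?case
  proof (cases G)
    case (GOut r s Gs)
    with 0 have "r \<noteq> p" using bar_GOut_here by metis
    moreover from 0 GOut obtain l G' where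
      "avoiding_path p G = LCons (COut r s l) (avoiding_path p G')"
      by (metis avoiding_path_GOut)
    ultimately show ?thesis using 0 by auto
  next
    case (GIn r s l G')
    with 0 have "r \<noteq> p" using bar_GIn_here by metis
    then show ?thesis using 0 GIn by (auto simp: avoiding_path_GIn)
  next
    case GEnd
    then show ?thesis using 0 by (simp add: avoiding_path_GEnd)
  qed
next
  case (Suc n)
  show ?case
  proof (cases G)
    case (GOut r s Gs)
    with Suc.prems obtain l G' where "\<not> bar p G'"
      "avoiding_path p G = LCons (COut r s l) (avoiding_path p G')"
      by (metis avoiding_path_GOut)
    then show ?thesis using Suc by auto
  next
    case (GIn r s l G')
    moreover from this Suc.prems have "\<not> bar p G'" using bar_GIn by metis
    ultimately show ?thesis using Suc by (auto simp: avoiding_path_GIn)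
  next
    case GEnd
    then show ?thesis using Suc.prems by (simp add: avoiding_path_GEnd)
  qed
qed

lemma bar_if_finite_depth:
  assumes "p \<in> Plays_gtype G" "depth G p \<noteq> \<infinity>"
  shows "bar p G"
proof (rule ccontr)
  assume nb: "\<not> bar p G"
  have none: "{enat (Suc n) | n. \<exists>\<beta>. lnth n (avoiding_path p G) = Some \<beta> \<and> play \<beta> = p} = {}"
    using avoiding_path_avoids[OF nb] by blast
  \<comment> \<open>The infimum of the empty set in \<open>enat\<close> is \<infinity>, so this path
    alone makes the supremum infinite.\<close>
  have "depth_path (avoiding_path p G) p = \<infinity>"
    unfolding depth_path_def none by (simp add: Inf_enat_def)
  moreover have "depth_path (avoiding_path p G) p \<le> (SUP \<xi> \<in> Paths G. depth_path \<xi> p)"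
    using is_path_avoiding_path[OF nb] by (intro SUP_upper) (simp add: Paths_def)
  ultimately show False using assms by (simp add: depth_def)
qed

lemma subgtype_Plays: "subgtype G' G \<Longrightarrow> Plays_gtype G' \<subseteq> Plays_gtype G"
  by (induction rule: subgtype.induct) (auto simp: Plays_gtype_def intro: in_Plays_gtype.intros)

text \<open>Quantifying over all subterms makes the property pass to branches. The second conjunct
  ensures that a sender at the root has a label to send.\<close>

definition barred :: "('p, 'l) gtype \<Rightarrow> bool" where
  "barred G \<longleftrightarrow> (\<forall>G'. subgtype G' G \<longrightarrow>
     (\<forall>p \<in> Plays_gtype G'. bar p G') \<and> (\<forall>p q. G' \<noteq> GOut p q fmempty))"

lemma barred_if_bounded: "wf_gtype G \<Longrightarrow> bounded_gtype G \<Longrightarrow> barred G"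
  unfolding barred_def
proof (intro allI impI conjI ballI)
  fix G' p
  assume "bounded_gtype G" "subgtype G' G" "p \<in> Plays_gtype G'"
  then show "bar p G'"
    using subgtype_Plays unfolding bounded_gtype_def by (intro bar_if_finite_depth) fast+
next
  fix G' p q
  assume "wf_gtype G" "subgtype G' G"
  then show "G' \<noteq> GOut p q fmempty" by (auto simp: wf_gtype_def)
qed

lemma barred_GOut: "barred (GOut p q Gs) \<Longrightarrow> fmlookup Gs l = Some G \<Longrightarrow> barred G"
  unfolding barred_def using subgtype_GOut by fast

lemma barred_GIn: "barred (GIn p q l G) \<Longrightarrow> barred G"
  unfolding barred_def using subgtype_GIn by fast

lemma barred_Plays: "barred G \<Longrightarrow> p \<in> Plays_gtype G \<Longrightarrow> bar p G"
  unfolding barred_def using subgtype_refl by fast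

lemma barred_nonempty: "barred (GOut p q Gs) \<Longrightarrow> Gs \<noteq> fmempty"
  unfolding barred_def using subgtype_refl by fast


section \<open>Sessions following a global type\<close>

inductive root_player :: "('p, 'l) gtype \<Rightarrow> 'p \<Rightarrow> bool" where
  "root_player (GOut p q Gs) p"
| "root_player (GIn p q l G) p"

inductive branch :: "('p, 'l) gtype \<Rightarrow> ('p, 'l) gtype \<Rightarrow> bool" where
  "fmlookup Gs l = Some G \<Longrightarrow> branch (GOut p q Gs) G"
| "branch (GIn p q l G) G"

text \<open>The last two clauses also concern root players outside \<P>, since a participant of \<P>
  may have to wait for them. The last one covers every move of the root player, whatever label it
  chooses.\<close>

coinductive follows :: "'p set \<Rightarrow> ('p, 'l) gtype \<Rightarrow> ('p, 'l) session \<Rightarrow> bool" for \<P> where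
  "\<lbrakk> \<And>p. p \<in> \<P> \<Longrightarrow> fst S p \<noteq> Inact \<Longrightarrow> bar p G;
     \<And>s. root_player G s \<Longrightarrow> \<exists>\<beta> S'. step S \<beta> S' \<and> play \<beta> = s;
     \<And>\<beta> S'. root_player G (play \<beta>) \<Longrightarrow> step S \<beta> S' \<Longrightarrow> \<exists>G'. branch G G' \<and> follows \<P> G' S' \<rbrakk>
   \<Longrightarrow> follows \<P> G S"

lemma follows_bar: "follows \<P> G S \<Longrightarrow> p \<in> \<P> \<Longrightarrow> fst S p \<noteq> Inact \<Longrightarrow> bar p G"
  by (erule follows.cases) blast

lemma follows_enabled: "follows \<P> G S \<Longrightarrow> root_player G s \<Longrightarrow> \<exists>\<beta> S'. step S \<beta> S' \<and> play \<beta> = s"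
  by (erule follows.cases) blast

lemma follows_branch:
  "follows \<P> G S \<Longrightarrow> root_player G (play \<beta>) \<Longrightarrow> step S \<beta> S' \<Longrightarrow>
     \<exists>G'. branch G G' \<and> follows \<P> G' S'"
  by (erule follows.cases) blast

lemma follows_progress:
  assumes "follows \<P> G S" "steps S \<tau> S'" "p \<in> \<P>" "fst S' p \<noteq> Inact"
  shows "\<exists>\<tau>' \<beta> S''. play \<beta> = p \<and> steps S' (\<tau>' @ [\<beta>]) S''"
  using assms
proof (induction "length \<tau>" arbitrary: \<tau> S S' G rule: less_induct)
  case less
  note shorter = less.hyps
  \<comment> \<open>The argument at one root, shared by the four cases of the inner induction on
    \<open>bar\<close>. The alternative \<open>s = p\<close> serves the two base cases, which have
    no induction hypothesis.\<close>
  have step_towards: "\<exists>\<tau>' \<beta> S''. play \<beta> = p \<and> steps S' (\<tau>' @ [\<beta>]) S''"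
    if root_player: "root_player G s" and fol: "follows \<P> G S" and st: "steps S \<tau> S'"
      and act: "fst S' p \<noteq> Inact"
      and IH: "s = p \<or> (\<forall>G' S S'. branch G G' \<longrightarrow> follows \<P> G' S \<longrightarrow> steps S \<tau> S' \<longrightarrow>
         fst S' p \<noteq> Inact \<longrightarrow> (\<exists>\<tau>' \<beta> S''. play \<beta> = p \<and> steps S' (\<tau>' @ [\<beta>]) S''))"
    for G s S S'
  proof -
    obtain \<beta>0 S0 where \<beta>0: "step S \<beta>0 S0" "play \<beta>0 = s"
      using follows_enabled[OF fol root_player] by blast
    have cont: "\<exists>G'. branch G G' \<and> follows \<P> G' S1" if "step S \<beta> S1" "play \<beta> = s" for \<beta> S1
      using follows_branch[OF fol] root_player that by blast
    show ?thesis
    proof (cases "s \<in> play ` set \<tau>")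
      case True
      then have "\<exists>\<beta> \<in> set \<tau>. play \<beta> = s" by auto
      then obtain \<tau>1 \<beta> \<tau>2 where \<tau>: "\<tau> = \<tau>1 @ \<beta> # \<tau>2" and \<beta>: "play \<beta> = s"
        and first: "\<forall>\<alpha> \<in> set \<tau>1. play \<alpha> \<noteq> s"
        by (rule split_list_first_propE)
      obtain Sa Sb where S: "steps S \<tau>1 Sa" "step Sa \<beta> Sb" "steps Sb \<tau>2 S'"
        using st unfolding \<tau> by (auto simp: steps_append_iff steps_Cons_iff)
      have "play \<beta>0 = play \<beta>" "play \<beta> \<notin> play ` set \<tau>1" using \<beta>0(2) \<beta> first by auto
      from steps_pull_forward[OF S(1,2) \<beta>0(1) this]
      obtain S1 where S1: "step S \<beta> S1" "steps S1 \<tau>1 Sb" by blast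
      obtain G' where "follows \<P> G' S1" using cont[OF S1(1) \<beta>] by blast
      moreover have "steps S1 (\<tau>1 @ \<tau>2) S'" unfolding steps_append_iff using S1(2) S(3) by blast
      moreover have "length (\<tau>1 @ \<tau>2) < length \<tau>" by (simp add: \<tau>)
      \<comment> \<open>The outer induction applies: the trace has lost \<beta> but still ends in
        \<open>S'\<close>, so nothing has to be known about \<open>bar p G'\<close>.\<close>
      ultimately show ?thesis using shorter less.prems(3) act by blast
    next
      case False
      \<comment> \<open>The root communication can be performed after \<tau> as well as before it,
        and both orders end in \<open>S1\<close>.\<close>
      then obtain S1 where S1: "step S' \<beta>0 S1" "steps S0 \<tau> S1"
        using steps_diamond[OF st \<beta>0(1)] \<beta>0(2) by blast
      show ?thesis
      proof (cases "s = p")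
        case True
        moreover have "steps S' ([] @ [\<beta>0]) S1"
          using steps_Cons[OF S1(1) steps_Nil] by simp
        ultimately show ?thesis using \<beta>0 by blast
      next
        case False
        obtain G' where "branch G G'" "follows \<P> G' S0" using cont[OF \<beta>0] by blast
        moreover have "fst S1 p \<noteq> Inact" using step_other[OF S1(1)] \<beta>0 False act by auto
        \<comment> \<open>The inner hypothesis is used with the same \<tau>, now from
          \<open>S0\<close> to \<open>S1\<close>; prefixing the root communication gives a trace
          from \<open>S'\<close>.\<close>
        ultimately obtain \<tau>' \<beta> S'' where "play \<beta> = p" "steps S1 (\<tau>' @ [\<beta>]) S''"
          using IH False S1 by blast
        then have "play \<beta> = p \<and> steps S' ((\<beta>0 # \<tau>') @ [\<beta>]) S''"
          using steps_Cons[OF S1(1)] by simp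
        then show ?thesis by blast
      qed
    qed
  qed
  have "bar p G"
    by (rule follows_bar[OF less.prems(1,3) steps_active[OF less.prems(2,4)]])
  from this less.prems(1,2,4) show ?case
  proof (induction G arbitrary: S S' rule: bar.induct)
    case (bar_GOut_here q Gs)
    then show ?case using step_towards[OF root_player.intros(1)] by blast
  next
    case (bar_GIn_here q l G)
    then show ?case using step_towards[OF root_player.intros(2)] by blast
  next
    case (bar_GOut Gs r s)
    show ?case
      by (rule step_towards[OF root_player.intros(1) bar_GOut.prems])
        (use bar_GOut.IH in \<open>auto elim!: branch.cases\<close>)
  next
    case (bar_GIn G r s l)
    show ?case
      by (rule step_towards[OF root_player.intros(2) bar_GIn.prems])
        (use bar_GIn.IH in \<open>auto elim!: branch.cases\<close>)
  qed
qed


section \<open>From derivations to the invariant\<close>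

text \<open>The histories that arise along a branch of a derivation: each entry was itself derivable from
  the history before it, so that a cycle can be unfolded.\<close>

inductive justified :: "'p set \<Rightarrow> ('p, 'l) history \<Rightarrow> bool" for \<P> where
  justified_empty: "justified \<P> {}"
| justified_insert:
    "justified \<P> H \<Longrightarrow> typed \<P> H G S \<Longrightarrow> barred G \<Longrightarrow> justified \<P> (insert (S, G) H)"

text \<open>The earliest insertion of the pair is taken. Its history lacks the pair, so the
  derivation there cannot end in \<open>typed_Cycle\<close>, and one unfolding of a cycle
  suffices.\<close>

lemma justified_entry:
  "justified \<P> H \<Longrightarrow> (S, G) \<in> H \<Longrightarrow>
     \<exists>H'. justified \<P> H' \<and> typed \<P> H' G S \<and> (S, G) \<notin> H'"
proof (induction rule: justified.induct)
  case (justified_insert H G' S')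
  then show ?case by (cases "(S, G) \<in> H") blast+
qed simp

lemma justified_typed_noncyclic:
  assumes "justified \<P> H" "typed \<P> H G S"
  obtains H' where "justified \<P> H'" "typed \<P> H' G S" "(S, G) \<notin> H'"
  using assms justified_entry by (cases "(S, G) \<in> H") blast+

lemma Plays_net_iff: "p \<in> Plays_net N \<longleftrightarrow> N p \<noteq> Inact"
proof
  assume "N p \<noteq> Inact"
  then have "located_in p (N p) N"
    unfolding located_in_def by (intro conjI exI[of _ "N(p := Inact)"]) simp_all
  then show "p \<in> Plays_net N" unfolding Plays_net_def by blast
qed (auto simp: Plays_net_def located_in_def)

text \<open>Coinduction with the history existentially quantified: descending into a premise extends
  it, and meeting a cycle goes back to an older one.\<close>

lemma follows_if_typed:
  assumes "justified \<P> H" "typed \<P> H G S" "barred G"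
  shows "follows \<P> G S"
proof -
  have "\<exists>H. justified \<P> H \<and> typed \<P> H G S \<and> barred G" using assms by blast
  then show ?thesis
  proof (coinduction arbitrary: G S)
    case follows
    then obtain H where H: "justified \<P> H" "typed \<P> H G S" "(S, G) \<notin> H" and bar: "barred G"
      by (metis justified_typed_noncyclic)
    have ext: "justified \<P> (insert (S, G) H)" using H bar by (intro justified_insert)
    from H(2) have
      "(\<forall>p. p \<in> \<P> \<longrightarrow> fst S p \<noteq> Inact \<longrightarrow> bar p G) \<and>
       (\<forall>s. root_player G s \<longrightarrow> (\<exists>\<beta> S'. step S \<beta> S' \<and> play \<beta> = s)) \<and>
       (\<forall>\<beta> S'. root_player G (play \<beta>) \<longrightarrow> step S \<beta> S' \<longrightarrow>
          (\<exists>G'. branch G G' \<and> (\<exists>H. justified \<P> H \<and> typed \<P> H G' S' \<and> barred G')))"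
    proof cases
      case (typed_End N M)
      then show ?thesis by (auto simp: Plays_net_iff elim: root_player.cases)
    next
      case (typed_Cycle N M)
      then show ?thesis using H(3) by simp
    next
      case (typed_Out p q Gs P Ps N M)
      have "bar r G" if "r \<in> \<P>" "fst S r \<noteq> Inact" for r
      proof (cases "r = p")
        case True
        then show ?thesis using typed_Out by (simp add: bar_GOut_here)
      next
        case False
        \<comment> \<open>By the side condition of the rule, the other active participants of \<P>
          occur in \<open>G\<close>, where boundedness yields \<open>bar\<close>.\<close>
        then show ?thesis using that typed_Out
          by (intro barred_Plays[OF bar]) (auto simp: Plays_net_iff)
      qed
      moreover have "\<exists>\<beta> S'. step S \<beta> S' \<and> play \<beta> = s" if "root_player G s" for s
      proof -
        have "Gs \<noteq> fmempty" using barred_nonempty bar typed_Out by metis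
        \<comment> \<open>Type and process offer the same labels, so the sender has a label to send.
          The same equality gives a branch for every label it may choose.\<close>
        then have "fmdom' Ps \<noteq> {}" using typed_Out
          by (metis fmdom'_empty fmrestrict_set_dom fmrestrict_set_null)
        then obtain l P' where "fmlookup Ps l = Some P'" by (auto simp: fmlookup_dom'_iff)
        then have "step S (COut p q l) (N(p := P'), M \<cdot> qsingle (p, l, q))"
          using typed_Out by (auto intro: step_Send)
        moreover have "s = p" using that typed_Out by (auto elim: root_player.cases)
        ultimately show ?thesis by (metis play.simps(1))
      qed
      moreover have "\<exists>G'. branch G G' \<and> (\<exists>H. justified \<P> H \<and> typed \<P> H G' S' \<and> barred G')"
        if r: "root_player G (play \<beta>)" and st: "step S \<beta> S'" for \<beta> S'
      proof -
        have "play \<beta> = p" using r typed_Out by (auto elim: root_player.cases)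
        then obtain l P' where l: "fmlookup Ps l = Some P'"
          and S': "S' = (N(p := P'), M \<cdot> qsingle (p, l, q))"
          using st typed_Out by (cases S') (auto simp: step_iff)
        have "l \<in> fmdom' Gs" using l typed_Out by (auto simp: fmlookup_dom'_iff)
        then obtain G' where G': "fmlookup Gs l = Some G'" by (auto simp: fmlookup_dom'_iff)
        have "typed \<P> (insert (S, G) H) G' S'"
          using typed_Out l G' S' by auto
        moreover have "barred G'" using bar barred_GOut G' typed_Out by metis
        moreover have "branch G G'" using G' typed_Out by (auto intro: branch.intros)
        ultimately show ?thesis using ext by blast
      qed
      ultimately show ?thesis by (intro conjI allI impI) simp_all
    next
      case (typed_In p q l G1 P Ps P1 N M)
      have "bar r G" if "r \<in> \<P>" "fst S r \<noteq> Inact" for r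
      proof (cases "r = p")
        case True
        then show ?thesis using typed_In by (simp add: bar_GIn_here)
      next
        case False
        then show ?thesis using that typed_In
          by (intro barred_Plays[OF bar]) (auto simp: Plays_net_iff)
      qed
      moreover have "\<exists>\<beta> S'. step S \<beta> S' \<and> play \<beta> = s" if "root_player G s" for s
      proof -
        have "step S (CIn p q l) (N(p := P1), M)" using typed_In by (auto intro: step_Rcv)
        moreover have "s = p" using that typed_In by (auto elim: root_player.cases)
        ultimately show ?thesis by (metis play.simps(2))
      qed
      moreover have "\<exists>G'. branch G G' \<and> (\<exists>H. justified \<P> H \<and> typed \<P> H G' S' \<and> barred G')"
        if r: "root_player G (play \<beta>)" and st: "step S \<beta> S'" for \<beta> S'
      proof -
        have "play \<beta> = p" using r typed_In by (auto elim: root_player.cases)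
        \<comment> \<open>The first message from \<open>q\<close> to \<open>p\<close> is unique, so
          \<open>p\<close> can read only the label named by the type.\<close>
        then have "S' = (N(p := P1), M)"
          using st typed_In by (cases S') (auto simp: step_iff dest: qsingle_qappend_cancel)
        then have "typed \<P> (insert (S, G) H) G1 S'" using typed_In by auto
        moreover have "barred G1" using bar barred_GIn typed_In by metis
        moreover have "branch G G1" using typed_In by (auto intro: branch.intros)
        ultimately show ?thesis using ext by blast
      qed
      ultimately show ?thesis by (intro conjI allI impI) simp_all
    qed
    then show ?case by (intro exI[of _ S] exI[of _ G]) blast
  qed
qed

theorem theorem3:
  fixes \<P> :: "'p set" and G :: "('p, 'l) gtype" and N :: "('p, 'l) net" and M :: "('p, 'l) queue"
  assumes "wf_gtype G" and "bounded_gtype G"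
    and "network N"
    and "typed \<P> {} G (N, M)"
  shows "lock_free \<P> (N, M)"
proof -
  have "follows \<P> G (N, M)"
    using follows_if_typed[OF justified_empty assms(4) barred_if_bounded[OF assms(1,2)]] .
  then show ?thesis
    unfolding lock_free_def lock_free_at_def located_in_def
    using follows_progress by fastforce
qed

end
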